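(* Let $\mathbb{F}$ be a field. If a finite group $G$ acts freely on a finite nonempty set $X$, then $$\text{the number of orbits of }G\text{ on }X=\dim(L^G(X))=\frac{|X|}{|G|}.$$ Therefore, if $|G|$ does not divide $|X|$, then $G$ does not act freely on $X$.
   Context: An action of $G$ on $X$, written $a\cdot x$, is free if for all $a\in G$, $x\in X$, $a\cdot x=x$ implies $a=e$, the identity of $G$. $L(X)$ denotes the $\mathbb{F}$-vector space of all functions from $X$ to $\mathbb{F}$ with pointwise operations, and $L^G(X)=\{f\in L(X)\colon f(a\cdot x)=f(x)\text{ for all }a\in G, x\in X\}$. Dimension is over $\mathbb{F}$. *)

theory Defs
  imports Complex_Main "HOL-Algebra.Group_Action" "HOL-Library.Function_Algebras"
begin

definition acts_freely ::
    "('g, 'm) monoid_scheme \<Rightarrow> 'x set \<Rightarrow> ('g \<Rightarrow> 'x \<Rightarrow> 'x) \<Rightarrow> bool" where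
  "acts_freely G X \<phi> \<longleftrightarrow>
     group_action G X \<phi> \<and> (\<forall>a\<in>carrier G. \<forall>x\<in>X. \<phi> a x = x \<longrightarrow> a = \<one>\<^bsub>G\<^esub>)"

text \<open>The vector space of all functions from the ambient type of \<open>X\<close> to the field, with pointwise
  operations (addition comes from \<open>Function_Algebras\<close>).\<close>

definition fun_scale :: "'f::field \<Rightarrow> ('x \<Rightarrow> 'f) \<Rightarrow> 'x \<Rightarrow> 'f" where
  "fun_scale c f = (\<lambda>x. c * f x)"

global_interpretation fun_space: vector_space "fun_scale :: 'f::field \<Rightarrow> ('x \<Rightarrow> 'f) \<Rightarrow> 'x \<Rightarrow> 'f"
  by unfold_locales (auto simp: fun_scale_def fun_eq_iff algebra_simps)

text \<open>A function on the set \<open>X\<close> is represented by its extension by zero. This gives each function on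
  \<open>X\<close> exactly one representative and, unlike extension by \<open>undefined\<close>, makes \<open>L X\<close> a subspace.\<close>

definition L :: "'x set \<Rightarrow> ('x \<Rightarrow> 'f::field) set" where
  "L X = {f. \<forall>x. x \<notin> X \<longrightarrow> f x = 0}"

definition L_inv ::
    "('g, 'm) monoid_scheme \<Rightarrow> 'x set \<Rightarrow> ('g \<Rightarrow> 'x \<Rightarrow> 'x) \<Rightarrow> ('x \<Rightarrow> 'f::field) set" where
  "L_inv G X \<phi> = {f \<in> L X. \<forall>a\<in>carrier G. \<forall>x\<in>X. f (\<phi> a x) = f x}"

lemma subspace_L: "fun_space.subspace (L X)"
  by (auto simp: fun_space.subspace_def L_def fun_scale_def)

lemma subspace_L_inv: "fun_space.subspace (L_inv G X \<phi>)"
  by (auto simp: fun_space.subspace_def L_inv_def L_def fun_scale_def)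

end

(* The indicator functions of the orbits form a basis of the space of invariant functions, so its
   dimension is the number of orbits. Freeness makes each orbit map a \<mapsto> a x injective, so every
   orbit has |G| elements, and the orbits partition X. *)
theory Submission
  imports Defs "HOL-Library.Indicator_Function"
begin

lemma sum_fun_scale_apply:
  "(\<Sum>i\<in>A. fun_scale (c i) (f i)) x = (\<Sum>i\<in>A. c i * f i x)"
  by (induction A rule: infinite_finite_induct) (simp_all add: fun_scale_def)

text \<open>At a point of \<open>A\<close> the indicators of all other members of \<open>P\<close>
  vanish, so evaluation there reads off one coefficient. Both the independence and the spanning
  argument rest on this.\<close>

lemma sum_indicator_disjoint:
  fixes c :: "'x set \<Rightarrow> 'f::field"
  assumes "finite P" "disjoint P" "A \<in> P" "x \<in> A"
  shows "(\<Sum>B\<in>P. c B * indicator B x) = c A"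
proof -
  have "(\<Sum>B\<in>P. c B * indicator B x) = (\<Sum>B\<in>P. if B = A then c A else 0)"
    using assms by (intro sum.cong) (auto simp: indicator_def disjoint_def)
  then show ?thesis
    using assms by simp
qed

text \<open>Since 1 and 0 differ in a field, a set is recovered as the points where its indicator is
  1. Hence sums over the indicators can be indexed by the sets, and there are as many basis vectors
  as orbits.\<close>

lemma inj_on_indicator: "inj_on (indicator :: 'x set \<Rightarrow> 'x \<Rightarrow> 'f::field) P"
proof (rule inj_onI)
  fix A B :: "'x set"
  assume "(indicator A :: 'x \<Rightarrow> 'f) = indicator B"
  then have "(indicator A x :: 'f) = 1 \<longleftrightarrow> (indicator B x :: 'f) = 1" for x
    by simp
  then show "A = B"
    by (simp add: indicator_eq_1_iff set_eq_iff)
qed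

text \<open>Evaluating a vanishing combination at a point of \<open>A\<close> isolates the
  coefficient of its indicator; nonemptiness supplies the point.\<close>

lemma independent_indicators:
  assumes "finite P" "disjoint P" "{} \<notin> P"
  shows "fun_space.independent ((indicator :: 'x set \<Rightarrow> 'x \<Rightarrow> 'f::field) ` P)"
proof (rule fun_space.independent_if_scalars_zero)
  show "finite ((indicator :: 'x set \<Rightarrow> 'x \<Rightarrow> 'f) ` P)"
    using assms by simp
next
  fix u :: "('x \<Rightarrow> 'f) \<Rightarrow> 'f" and h :: "'x \<Rightarrow> 'f"
  assume zero: "(\<Sum>f\<in>indicator ` P. fun_scale (u f) f) = 0" and "h \<in> indicator ` P"
  then obtain A where A: "A \<in> P" "h = indicator A"
    by blast
  with assms obtain x where "x \<in> A"
    by (metis all_not_in_conv)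
  have "0 = (\<Sum>f\<in>indicator ` P. fun_scale (u f) f) x"
    by (simp add: zero)
  also have "\<dots> = (\<Sum>B\<in>P. u (indicator B) * indicator B x)"
    by (simp only: sum.reindex[OF inj_on_indicator] o_def sum_fun_scale_apply)
  also have "\<dots> = u h"
    using sum_indicator_disjoint[OF assms(1,2) A(1) \<open>x \<in> A\<close>] A by simp
  finally show "u h = 0"
    by simp
qed

context group_action
begin

lemma disjoint_orbits: "disjoint (orbits G E \<phi>)"
  using disjoint_union by (auto simp: disjoint_def)

lemma empty_notin_orbits: "{} \<notin> orbits G E \<phi>"
  using orbit_refl by (auto simp: orbits_def)

lemma orbits_closed:
  assumes "A \<in> orbits G E \<phi>" "a \<in> carrier G" "x \<in> E"
  shows "\<phi> a x \<in> A \<longleftrightarrow> x \<in> A"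
proof -
  \<comment> \<open>\<open>B\<close> is the orbit of \<open>x\<close>. Orbits that meet coincide, so
    if \<open>A\<close> contains either of the two points, then \<open>A = B\<close> and it contains
    both.\<close>
  obtain B where B: "B \<in> orbits G E \<phi>" "x \<in> B" "\<phi> a x \<in> B"
    using assms orbit_refl[OF assms(3)] unfolding orbits_def orbit_def by blast
  show ?thesis
    using disjoint_union[OF assms(1) B(1)] B(2,3) by blast
qed

lemma indicator_orbit_in_L_inv:
  assumes "A \<in> orbits G E \<phi>"
  shows "(indicator A :: 'c \<Rightarrow> 'f::field) \<in> L_inv G E \<phi>"
  using assms orbits_closed[OF assms] orbits_coverture
  by (auto simp: L_inv_def L_def indicator_def)

text \<open>An invariant function is constant on each orbit, so it is the combination of the orbit
  indicators weighted by these constant values.\<close>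

lemma L_inv_subset_span:
  assumes "finite E"
  shows "(L_inv G E \<phi> :: ('c \<Rightarrow> 'f::field) set)
    \<subseteq> fun_space.span (indicator ` orbits G E \<phi>)"
proof
  fix f :: "'c \<Rightarrow> 'f"
  assume f: "f \<in> L_inv G E \<phi>"
  \<comment> \<open>The coefficient is the value at an arbitrary representative; invariance of
    \<open>f\<close> makes the choice irrelevant.\<close>
  define c where "c A = f (SOME y. y \<in> A)" for A
  have fin: "finite (orbits G E \<phi>)"
    using assms by (auto simp: orbits_def)
  have "f x = (\<Sum>A\<in>orbits G E \<phi>. c A * indicator A x)" for x
  proof (cases "x \<in> E")
    case True
    let ?A = "orbit G \<phi> x"
    have A: "?A \<in> orbits G E \<phi>" "x \<in> ?A"
      using True orbit_refl by (auto simp: orbits_def)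
    then have "(SOME y. y \<in> ?A) \<in> ?A"
      by (metis someI)
    then have "c ?A = f x"
      using f True by (auto simp: c_def orbit_def L_inv_def)
    then show ?thesis
      using sum_indicator_disjoint[OF fin disjoint_orbits A, of c] by simp
  next
    \<comment> \<open>Equality is needed on the whole ambient type: off \<open>E\<close> the
      function is zero by the extension convention, and no orbit reaches there.\<close>
    case False
    then have "indicator A x = (0::'f)" if "A \<in> orbits G E \<phi>" for A
      using that orbits_coverture by (auto simp: indicator_def)
    moreover have "f x = 0"
      using f False by (simp add: L_inv_def L_def)
    ultimately show ?thesis
      by simp
  qed
  then have eq: "f = (\<Sum>A\<in>orbits G E \<phi>. fun_scale (c A) (indicator A))"
    by (simp add: fun_eq_iff sum_fun_scale_apply)
  show "f \<in> fun_space.span (indicator ` orbits G E \<phi>)"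
    unfolding eq
    by (rule fun_space.span_sum, rule fun_space.span_scale, rule fun_space.span_base, rule imageI)
qed

lemma dim_L_inv:
  assumes "finite E"
  shows "fun_space.dim (L_inv G E \<phi> :: ('c \<Rightarrow> 'f::field) set) = card (orbits G E \<phi>)"
proof (rule fun_space.dim_unique)
  let ?B = "(indicator :: 'c set \<Rightarrow> 'c \<Rightarrow> 'f) ` orbits G E \<phi>"
  show "?B \<subseteq> L_inv G E \<phi>"
    using indicator_orbit_in_L_inv by blast
  show "L_inv G E \<phi> \<subseteq> fun_space.span ?B"
    using assms by (rule L_inv_subset_span)
  have "finite (orbits G E \<phi>)"
    using assms by (auto simp: orbits_def)
  then show "fun_space.independent ?B"
    using disjoint_orbits empty_notin_orbits by (rule independent_indicators)
  show "card ?B = card (orbits G E \<phi>)"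
    by (rule card_image[OF inj_on_indicator])
qed

end

text \<open>If \<open>g\<close> and \<open>h\<close> send \<open>x\<close> to the same point, then
  the inverse of \<open>h\<close> times \<open>g\<close> fixes \<open>x\<close>, so freeness makes
  it the identity. Thus the map from the group onto the orbit of \<open>x\<close> is a
  bijection.\<close>

lemma card_orbit_free:
  assumes "acts_freely G X \<phi>" "x \<in> X"
  shows "card (orbit G \<phi> x) = order G"
proof -
  interpret group_action G X \<phi>
    using assms by (simp add: acts_freely_def)
  interpret group G
    using group_hom by (rule group_hom.axioms(1))
  have "inj_on (\<lambda>g. \<phi> g x) (carrier G)"
  proof (rule inj_onI)
    fix g h
    assume gh: "g \<in> carrier G" "h \<in> carrier G" and eq: "\<phi> g x = \<phi> h x"
    have "\<phi> (inv\<^bsub>G\<^esub> h \<otimes>\<^bsub>G\<^esub> g) x = \<phi> (inv\<^bsub>G\<^esub> h) (\<phi> h x)"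
      using composition_rule[OF assms(2)] gh eq by simp
    also have "\<dots> = x"
      using orbit_sym_aux[OF gh(2) assms(2)] by simp
    finally have "inv\<^bsub>G\<^esub> h \<otimes>\<^bsub>G\<^esub> g = \<one>\<^bsub>G\<^esub>"
      using assms gh unfolding acts_freely_def by (blast intro: m_closed inv_closed)
    then show "g = h"
      using gh inv_solve_left'[of "\<one>\<^bsub>G\<^esub>" h g] by simp
  qed
  moreover have "orbit G \<phi> x = (\<lambda>g. \<phi> g x) ` carrier G"
    by (auto simp: orbit_def)
  ultimately show ?thesis
    by (simp add: card_image order_def)
qed

lemma card_eq_orbits_times_order:
  assumes "acts_freely G X \<phi>" "finite X"
  shows "card X = card (orbits G X \<phi>) * order G"
proof -
  interpret group_action G X \<phi>
    using assms by (simp add: acts_freely_def)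
  \<comment> \<open>The orbits partition \<open>X\<close>, so summing the constant 1 orbit by orbit
    counts \<open>X\<close>.\<close>
  have "card X = (\<Sum>A\<in>orbits G X \<phi>. card A)"
    using disjoint_sum[OF assms(2), of "\<lambda>_. 1::nat"] by simp
  also have "\<dots> = (\<Sum>A\<in>orbits G X \<phi>. order G)"
    using card_orbit_free[OF assms(1)] by (intro sum.cong) (auto simp: orbits_def)
  finally show ?thesis
    by simp
qed

theorem corollary3p4:
  fixes G :: "('g, 'm) monoid_scheme" and X :: "'x set"
  assumes "group G" and "finite (carrier G)" and "finite X" and "X \<noteq> {}"
  shows "(\<forall>\<phi>. acts_freely G X \<phi> \<longrightarrow>
            card (orbits G X \<phi>) = fun_space.dim (L_inv G X \<phi> :: ('x \<Rightarrow> 'f::field) set) \<and>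
            rat_of_nat (fun_space.dim (L_inv G X \<phi> :: ('x \<Rightarrow> 'f) set)) =
              rat_of_nat (card X) / rat_of_nat (order G))
       \<and> (\<not> order G dvd card X \<longrightarrow> \<not> (\<exists>\<phi>. acts_freely G X \<phi>))"
proof (intro conjI allI impI)
  fix \<phi> assume free: "acts_freely G X \<phi>"
  then interpret group_action G X \<phi>
    by (simp add: acts_freely_def)
  show dim: "card (orbits G X \<phi>) = fun_space.dim (L_inv G X \<phi> :: ('x \<Rightarrow> 'f) set)"
    by (simp add: dim_L_inv[OF assms(3)])
  \<comment> \<open>The finite carrier contains the identity, so its cardinality is positive and the
    factor \<open>order G\<close> of \<open>card X\<close> cancels in the quotient.\<close>
  have "order G \<noteq> 0"
    using assms(2) monoid.one_closed[OF group.is_monoid[OF assms(1)]] by (auto simp: order_def)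
  then show "rat_of_nat (fun_space.dim (L_inv G X \<phi> :: ('x \<Rightarrow> 'f) set)) =
      rat_of_nat (card X) / rat_of_nat (order G)"
    by (simp add: card_eq_orbits_times_order[OF free assms(3)] flip: dim)
next
  assume "\<not> order G dvd card X"
  then show "\<not> (\<exists>\<phi>. acts_freely G X \<phi>)"
    \<comment> \<open>A free action would exhibit \<open>card X\<close> as a multiple of
      \<open>order G\<close>, with the number of orbits as cofactor.\<close>
    using card_eq_orbits_times_order[OF _ assms(3)] by (metis dvd_triv_right)
qed

end
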